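(* Let $S$ be a $*$-monoid and let $a\in S$ satisfy $(a^{2})^{*}=a^{2}$. Then the following conditions are equivalent: (1) $a$ is group invertible; (2) $a$ is both group invertible and Moore--Penrose invertible; (3) $a$ is EP.
   Context: A $*$-monoid is a monoid $S$ with an involution, i.e. a map $*:S\to S$ with $(a^{*})^{*}=a$ and $(ab)^{*}=b^{*}a^{*}$ for all $a,b\in S$. An element $a\in S$ is Moore--Penrose invertible if there is $x\in S$ with $axa=a$, $xax=x$, $(ax)^{*}=ax$, $(xa)^{*}=xa$; such $x$ is unique and denoted $a^{\dag}$. An element $a\in S$ is group invertible if there is $x\in S$ with $axa=a$, $xax=x$, $ax=xa$; such $x$ is unique and denoted $a^{\#}$. An element $a$ is EP if it is both Moore--Penrose invertible and group invertible and $a^{\dag}=a^{\#}$. *)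

theory Defs
  imports Main
begin

class star_monoid = monoid_mult +
  fixes star :: "'a \<Rightarrow> 'a"
  assumes star_star: "star (star a) = a"
    and star_mult: "star (a * b) = star b * star a"

definition is_MP_inverse :: "'a::star_monoid \<Rightarrow> 'a \<Rightarrow> bool" where
  "is_MP_inverse a x \<longleftrightarrow>
     a * x * a = a \<and> x * a * x = x \<and> star (a * x) = a * x \<and> star (x * a) = x * a"

definition MP_invertible :: "'a::star_monoid \<Rightarrow> bool" where
  "MP_invertible a \<longleftrightarrow> (\<exists>x. is_MP_inverse a x)"

definition is_group_inverse :: "'a::monoid_mult \<Rightarrow> 'a \<Rightarrow> bool" where
  "is_group_inverse a x \<longleftrightarrow> a * x * a = a \<and> x * a * x = x \<and> a * x = x * a"

definition group_invertible :: "'a::monoid_mult \<Rightarrow> bool" where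
  "group_invertible a \<longleftrightarrow> (\<exists>x. is_group_inverse a x)"

lemma is_MP_inverse_unique:
  fixes a :: "'a::star_monoid"
  assumes x: "is_MP_inverse a x" and y: "is_MP_inverse a y"
  shows "x = y"
proof -
  have x1: "a * x * a = a" and x2: "x * a * x = x"
    and x3: "star (a * x) = a * x" and x4: "star (x * a) = x * a"
    using x unfolding is_MP_inverse_def by auto
  have y1: "a * y * a = a" and y2: "y * a * y = y"
    and y3: "star (a * y) = a * y" and y4: "star (y * a) = y * a"
    using y unfolding is_MP_inverse_def by auto
  have "a * x = star (a * y * a * x)"
    using y1 x3 by simp
  also have "\<dots> = star ((a * y) * (a * x))"
    by (simp add: mult.assoc)
  also have "\<dots> = (a * x) * (a * y)"
    by (simp only: star_mult[of "a * y" "a * x"] x3 y3)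
  also have "\<dots> = a * x * a * y"
    by (simp add: mult.assoc)
  finally have ax: "a * x = a * y"
    using x1 by simp
  have "x * a = star (x * (a * y * a))"
    using y1 x4 by simp
  also have "\<dots> = star ((x * a) * (y * a))"
    by (simp add: mult.assoc)
  also have "\<dots> = (y * a) * (x * a)"
    by (simp only: star_mult[of "x * a" "y * a"] x4 y4)
  also have "\<dots> = y * (a * x * a)"
    by (simp add: mult.assoc)
  finally have xa: "x * a = y * a"
    using x1 by simp
  have "x = x * a * x" using x2 by simp
  also have "\<dots> = y * (a * x)" using xa by (simp add: mult.assoc)
  also have "\<dots> = y * a * y" using ax by (simp add: mult.assoc)
  finally show ?thesis using y2 by simp
qed

lemma is_group_inverse_unique:
  fixes a :: "'a::monoid_mult"
  assumes x: "is_group_inverse a x" and y: "is_group_inverse a y"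
  shows "x = y"
proof -
  have x1: "a * x * a = a" and x2: "x * a * x = x" and x3: "a * x = x * a"
    using x unfolding is_group_inverse_def by auto
  have y1: "a * y * a = a" and y2: "y * a * y = y" and y3: "a * y = y * a"
    using y unfolding is_group_inverse_def by auto
  have "x * a = x * (a * y * a)" using y1 by simp
  also have "\<dots> = (x * a) * (y * a)" by (simp add: mult.assoc)
  also have "\<dots> = (a * x) * (a * y)" by (simp only: x3 y3)
  also have "\<dots> = (a * x * a) * y" by (simp add: mult.assoc)
  finally have xa: "x * a = a * y" using x1 by simp
  have "x = x * a * x" using x2 by simp
  also have "\<dots> = y * (a * x)" using xa y3 by (simp add: mult.assoc)
  also have "\<dots> = y * a * y" using xa x3 by (simp add: mult.assoc)
  finally show ?thesis using y2 by simp
qed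

text \<open>The two inverses below are unspecified outside the invertible elements.\<close>

definition MP_inverse :: "'a::star_monoid \<Rightarrow> 'a" where
  "MP_inverse a = (THE x. is_MP_inverse a x)"

definition group_inverse :: "'a::monoid_mult \<Rightarrow> 'a" where
  "group_inverse a = (THE x. is_group_inverse a x)"

lemma is_MP_inverse_MP_inverse: "MP_invertible a \<Longrightarrow> is_MP_inverse a (MP_inverse a)"
  unfolding MP_invertible_def MP_inverse_def
  by (metis is_MP_inverse_unique theI)

lemma is_group_inverse_group_inverse:
  "group_invertible a \<Longrightarrow> is_group_inverse a (group_inverse a)"
  unfolding group_invertible_def group_inverse_def
  by (metis is_group_inverse_unique theI)

definition EP :: "'a::star_monoid \<Rightarrow> bool" where
  "EP a \<longleftrightarrow> MP_invertible a \<and> group_invertible a \<and> MP_inverse a = group_inverse a"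

end

theory Submission
  imports Defs
begin

text \<open>For a group inverse x of a, the idempotent e = a x = x a equals a^2 x^2, and a^2 e = a^2.
  As a^2 is self-adjoint, e* = (x^2)* a^2, so e* e = e*. The left-hand side is self-adjoint,
  hence e = e* and x is also the Moore-Penrose inverse of a.\<close>

lemma group_inverse_imp_MP_inverse:
  fixes a :: "'a::star_monoid"
  assumes sq: "star (a\<^sup>2) = a\<^sup>2" and x: "is_group_inverse a x"
  shows "is_MP_inverse a x"
proof -
  define e where "e = a * x"
  have axa: "a * x * a = a" and xax: "x * a * x = x" and comm: "a * x = x * a"
    using x by (auto simp: is_group_inverse_def)
  \<comment> \<open>Idempotence gives \<open>e = a * (x * a) * x\<close>, and \<open>comm\<close>
    swaps the middle factors.\<close>
  have e_sq: "e = a\<^sup>2 * x\<^sup>2"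
    using axa comm unfolding e_def power2_eq_square by (metis mult.assoc)
  have sq_e: "a\<^sup>2 * e = a\<^sup>2"
    using axa comm unfolding e_def power2_eq_square by (metis mult.assoc)
  have "star e = star (x\<^sup>2) * a\<^sup>2"
    by (simp add: e_sq star_mult sq)
  then have absorb: "star e * e = star e"
    using sq_e by (simp add: mult.assoc)
  have "star (star e * e) = star e * e"
    by (simp add: star_mult star_star)
  \<comment> \<open>By \<open>absorb\<close>, the previous identity reads
    \<open>star (star e) = star e\<close>.\<close>
  then have "star e = e"
    using absorb by (simp add: star_star)
  then show ?thesis
    using axa xax comm by (simp add: is_MP_inverse_def e_def)
qed

theorem corollary5p8:
  fixes a :: "'a::star_monoid"
  assumes "star (a\<^sup>2) = a\<^sup>2"
  shows "(group_invertible a \<longleftrightarrow> group_invertible a \<and> MP_invertible a) \<and>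
         (group_invertible a \<and> MP_invertible a \<longleftrightarrow> EP a)"
proof -
  \<comment> \<open>The only implication with content; the others drop conjuncts.\<close>
  have "MP_invertible a \<and> MP_inverse a = group_inverse a" if "group_invertible a"
  proof -
    have "is_MP_inverse a (group_inverse a)"
      using assms that by (intro group_inverse_imp_MP_inverse is_group_inverse_group_inverse)
    \<comment> \<open>Uniqueness of the Moore-Penrose inverse identifies the chosen value
      \<open>MP_inverse a\<close> with \<open>group_inverse a\<close>.\<close>
    then show ?thesis
      by (metis MP_invertible_def is_MP_inverse_MP_inverse is_MP_inverse_unique)
  qed
  then show ?thesis
    unfolding EP_def by blast
qed

end
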